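(* Let $H$ be a real Hilbert space (of functions) with norm $\|\cdot\|$, let $a(\cdot,\cdot)$ be a symmetric $H$-elliptic bilinear form on $H$, $b$ a continuous linear functional on $H$, $\Psi(u)=\frac12a(u,u)-b(u)$, and $\hat u:=\operatorname{argmin}_{u\in H}\Psi(u)$. Let $\|v\|_E=\sqrt{a(v,v)}$ be the energy norm, and let $c_1,c_2>0$ be such that $c_1\|v\|\le\|v\|_E\le c_2\|v\|$ for all $v\in H$. Let $F(\cdot;\alpha):H\to H$, $\alpha\in\mathbb{R}^M$, be a family of Read-Bajactarević (RB) operators such that $F(u;\alpha)$ is a linear function of $(u,\alpha)\in H\times\mathbb{R}^M$ (so that $F(u;\alpha)=F(u;0)+F(0;\alpha)$), and which is contractive with constant $c\in(0,1)$, i.e. $\|F(u;\alpha)-F(v;\alpha)\|\le c\|u-v\|$ for all $u,v\in H$ and $\alpha\in\mathbb{R}^M$, where $c<c_1/c_2$; put $\gamma:=c\,c_2/c_1<1$. Let $W:=\{F(0;\alpha)\mid\alpha\in\mathbb{R}^M\}$, $W(u):=F(u;0)+W$, $G(u):=\operatorname{argmin}_{w\in W(u)}\Psi(w)$ for $u\in H$, and $V_N:=\{u_\alpha\mid\alpha\in\mathbb{R}^M,\ u_\alpha=F(u_\alpha;\alpha)\}$. Let $\tilde u_N\in V_N$ be the collage fit, i.e. the unique element of $V_N$ with $\tilde u_N=G(\tilde u_N)$. Then $$\|\tilde u_N-\hat u\|\le\frac{1/c+1}{1/\gamma-1}\,\|u_N-\hat u\|\quad\text{for all }u_N\in V_N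.$$
   Context: $H$-elliptic means that the bilinear form $a$ is continuous and coercive on $H$, so that the energy norm is equivalent to the norm of $H$. RB operators: the elements of $H$ are real-valued functions (or classes of functions) on a set $\mathbb{X}$. Given subsets $\mathbb{X}_1,\dots,\mathbb{X}_N\subseteq\mathbb{X}$ and injective maps $u_i:\mathbb{X}_i\to\mathbb{X}$ whose images $u_i(\mathbb{X}_i)$ partition $\mathbb{X}$, and maps $v_i:\mathbb{X}_i\times\mathbb{R}\to\mathbb{R}$, the associated RB operator sends $f$ to the function equal to $v_i(u_i^{-1}(x),f(u_i^{-1}(x)))$ for $x\in u_i(\mathbb{X}_i)$, $i=1,\dots,N$. Here $F(\cdot;\alpha)$ is a family of such operators mapping $H$ to $H$, depending on a parameter vector $\alpha\in\mathbb{R}^M$. Existence and uniqueness of the collage fit $\tilde u_N$ under these hypotheses holds because $G$ is a contraction of $H$ with constant $\gamma$ whose fixed point lies in $V_N$. *)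

theory Defs
  imports "HOL-Analysis.Analysis"
begin

section \<open>Hilbert spaces of (classes of) functions\<close>

text \<open>
  \<open>reps h\<close> is the set of functions representing the vector \<open>h\<close>; only their values on \<open>X\<close>
  matter. The conditions say that the sets \<open>reps h\<close> are the classes of a linear space of
  functions on \<open>X\<close> modulo the subspace \<open>reps 0\<close>, with the induced vector space
  operations. If \<open>reps 0\<close> contains only functions vanishing on \<open>X\<close>, the vectors are genuine
  functions on \<open>X\<close>; if \<open>reps 0\<close> consists of the a.e. vanishing functions, they are classes
  as in \<open>L\<^sup>2\<close>.
\<close>
definition function_space_on :: "'x set \<Rightarrow> ('h::real_vector \<Rightarrow> ('x \<Rightarrow> real) set) \<Rightarrow> bool" where
  "function_space_on X reps \<longleftrightarrow>
     (\<forall>h. reps h \<noteq> {}) \<and>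
     (\<forall>h h' f. f \<in> reps h \<and> f \<in> reps h' \<longrightarrow> h = h') \<and>
     (\<forall>h f g. f \<in> reps h \<and> (\<forall>x\<in>X. g x = f x) \<longrightarrow> g \<in> reps h) \<and>
     (\<forall>h h' f f'. f \<in> reps h \<and> f' \<in> reps h' \<longrightarrow> (\<lambda>x. f x + f' x) \<in> reps (h + h')) \<and>
     (\<forall>r h f. f \<in> reps h \<longrightarrow> (\<lambda>x. r * f x) \<in> reps (r *\<^sub>R h))"

section \<open>Read-Bajactarevic operators\<close>

definition rb_partition ::
    "'x set \<Rightarrow> nat \<Rightarrow> (nat \<Rightarrow> 'x set) \<Rightarrow> (nat \<Rightarrow> 'x \<Rightarrow> 'x) \<Rightarrow> bool" where
  "rb_partition X N Xs u \<longleftrightarrow>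
     (\<forall>i\<in>{1..N}. Xs i \<subseteq> X \<and> inj_on (u i) (Xs i)) \<and>
     disjoint_family_on (\<lambda>i. u i ` Xs i) {1..N} \<and>
     (\<Union>i\<in>{1..N}. u i ` Xs i) = X"

definition rb_fun ::
    "nat \<Rightarrow> (nat \<Rightarrow> 'x set) \<Rightarrow> (nat \<Rightarrow> 'x \<Rightarrow> 'x) \<Rightarrow> (nat \<Rightarrow> 'x \<Rightarrow> real \<Rightarrow> real)
      \<Rightarrow> ('x \<Rightarrow> real) \<Rightarrow> 'x \<Rightarrow> real" where
  "rb_fun N Xs u v f x =
     (let i = (THE i. i \<in> {1..N} \<and> x \<in> u i ` Xs i);
          y = inv_into (Xs i) (u i) x
      in v i y (f y))"

text \<open>
  For classes of functions the pointwise formula is required for every representative, so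
  that the operator is well defined on classes.
\<close>
definition rb_operator ::
    "'x set \<Rightarrow> ('h \<Rightarrow> ('x \<Rightarrow> real) set) \<Rightarrow> ('h \<Rightarrow> 'h) \<Rightarrow> bool" where
  "rb_operator X reps T \<longleftrightarrow>
     (\<exists>N Xs u v. rb_partition X N Xs u \<and>
        (\<forall>h. \<forall>f\<in>reps h. rb_fun N Xs u v f \<in> reps (T h)))"

section \<open>Elliptic forms and the energy functional\<close>

definition H_elliptic :: "('h::real_normed_vector \<Rightarrow> 'h \<Rightarrow> real) \<Rightarrow> bool" where
  "H_elliptic a \<longleftrightarrow>
     bounded_bilinear a \<and> (\<exists>k>0. \<forall>v. k * (norm v)\<^sup>2 \<le> a v v)"

definition energy_norm :: "('h \<Rightarrow> 'h \<Rightarrow> real) \<Rightarrow> 'h \<Rightarrow> real" where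
  "energy_norm a v = sqrt (a v v)"

definition Psi :: "('h \<Rightarrow> 'h \<Rightarrow> real) \<Rightarrow> ('h \<Rightarrow> real) \<Rightarrow> 'h \<Rightarrow> real" where
  "Psi a b u = 1/2 * a u u - b u"

text \<open>
  \<open>arg_min\<close> is a Hilbert choice of a minimizer. For an elliptic form \<open>a\<close> and continuous \<open>b\<close>
  it is determined in both uses below, since \<open>Psi\<close> has exactly one minimizer on every nonempty
  closed affine subspace.
\<close>
definition Psi_minimizer :: "('h \<Rightarrow> 'h \<Rightarrow> real) \<Rightarrow> ('h \<Rightarrow> real) \<Rightarrow> 'h set \<Rightarrow> 'h" where
  "Psi_minimizer a b S = arg_min (Psi a b) (\<lambda>w. w \<in> S)"

section \<open>The collage fit\<close>

definition W_space :: "('h::real_vector \<Rightarrow> 'p \<Rightarrow> 'h) \<Rightarrow> 'h set" where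
  "W_space F = {F 0 \<alpha> | \<alpha>. True}"

definition W_affine :: "('h::real_vector \<Rightarrow> 'p::zero \<Rightarrow> 'h) \<Rightarrow> 'h \<Rightarrow> 'h set" where
  "W_affine F u = {F u 0 + w | w. w \<in> W_space F}"

definition G_op ::
    "('h::real_vector \<Rightarrow> 'h \<Rightarrow> real) \<Rightarrow> ('h \<Rightarrow> real) \<Rightarrow> ('h \<Rightarrow> 'p::zero \<Rightarrow> 'h) \<Rightarrow> 'h \<Rightarrow> 'h" where
  "G_op a b F u = Psi_minimizer a b (W_affine F u)"

definition V_space :: "('h \<Rightarrow> 'p \<Rightarrow> 'h) \<Rightarrow> 'h set" where
  "V_space F = {u. \<exists>\<alpha>. u = F u \<alpha>}"

definition collage_fit ::
    "('h::real_vector \<Rightarrow> 'h \<Rightarrow> real) \<Rightarrow> ('h \<Rightarrow> real) \<Rightarrow> ('h \<Rightarrow> 'p::zero \<Rightarrow> 'h) \<Rightarrow> 'h" where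
  "collage_fit a b F = (THE u. u \<in> V_space F \<and> u = G_op a b F u)"

end

theory Submission imports Defs begin

text \<open>
  The error of the collage fit is compared with that of any \<open>u\<close> in \<open>V_space F\<close> by the collage
  estimate. Since \<open>uhat\<close> represents \<open>b\<close> with respect to \<open>a\<close>, minimizing \<open>Psi\<close> over a set is
  the same as minimizing the energy distance to \<open>uhat\<close>; hence \<open>G u\<close> is the energy projection of
  \<open>uhat\<close> onto the finite-dimensional affine space \<open>W(u)\<close>. The difference \<open>G u - G v\<close> is
  energy-orthogonal to \<open>W\<close> and differs from \<open>F(u - v; 0)\<close> by an element of \<open>W\<close>, so Pythagoras
  bounds its energy norm by that of \<open>F(u - v; 0)\<close>, and passing between the two norms makes \<open>G\<close> a
  contraction with constant \<open>\<gamma> = c * c\<^sub>2 / c\<^sub>1\<close> (\<open>G_op_contraction\<close>). Its unique fixed point lies in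
  \<open>V_space F\<close> and is therefore the collage fit.

  For a contraction, the distance of any point, here \<open>uhat\<close>, to the fixed point is at most
  \<open>1 / (1 - \<gamma>)\<close> times the distance by which the point is moved. Finally \<open>uhat\<close> is moved only a
  little: if \<open>u = F(u; \<alpha>)\<close>, then \<open>F(uhat; \<alpha>)\<close> competes in the minimization that
  defines \<open>G uhat\<close>, and it has distance at most \<open>(1 + c) * norm (u - uhat)\<close> from \<open>uhat\<close>
  (\<open>G_op_displacement\<close>). Going to the energy norm and back costs the factor
  \<open>c\<^sub>2 / c\<^sub>1 = \<gamma> / c\<close>.
\<close>

section \<open>Minimization for elliptic forms\<close>

locale elliptic_form =
  fixes a :: "'h::{real_normed_vector,complete_space} \<Rightarrow> 'h \<Rightarrow> real"
  assumes sym: "a u v = a v u"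
    and elliptic: "H_elliptic a"
begin

lemma bounded_bilinear: "bounded_bilinear a"
  using elliptic by (simp add: H_elliptic_def)

sublocale bounded_bilinear a
  by (rule bounded_bilinear)

lemma coercive:
  obtains k where "k > 0" and "\<And>v. k * (norm v)\<^sup>2 \<le> a v v"
  using elliptic by (auto simp: H_elliptic_def)

lemma nonneg: "a v v \<ge> 0"
  by (metis coercive mult_nonneg_nonneg order_less_imp_le order_trans zero_le_power2)

lemma eq_0_iff: "a v v = 0 \<longleftrightarrow> v = 0"
proof
  assume "a v v = 0"
  moreover obtain k where "k > 0" and "k * (norm v)\<^sup>2 \<le> a v v"
    using coercive by metis
  ultimately show "v = 0"
    by (simp add: mult_le_0_iff)
qed (simp add: zero_left)

lemma form_add: "a (u + v) (u + v) = a u u + 2 * a u v + a v v"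
  using sym[of u v] by (simp add: add_left add_right)

lemma energy_norm_le_iff: "energy_norm a u \<le> energy_norm a v \<longleftrightarrow> a u u \<le> a v v"
  by (simp add: energy_norm_def)

lemma Psi_add:
  assumes "linear b"
  shows "Psi a b (u + v) = Psi a b u + (a u v - b v) + a v v / 2"
  by (simp add: Psi_def form_add linear_add[OF assms] field_simps)

lemma Psi_bounded_below:
  assumes "bounded_linear b"
  shows "bdd_below (range (Psi a b))"
proof -
  obtain k where k: "k > 0" "\<And>v. k * (norm v)\<^sup>2 \<le> a v v"
    using coercive by blast
  obtain B where B: "\<And>v. norm (b v) \<le> norm v * B"
    using bounded_linear.bounded[OF assms] by blast
  have "- B\<^sup>2 / (2 * k) \<le> Psi a b v" for v
  proof -
    have "0 \<le> (k * norm v - B)\<^sup>2 / (2 * k)"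
      using k(1) by simp
    also have "\<dots> = k * (norm v)\<^sup>2 / 2 - norm v * B + B\<^sup>2 / (2 * k)"
      using k(1) by (simp add: power2_eq_square field_simps)
    also have "\<dots> \<le> Psi a b v + B\<^sup>2 / (2 * k)"
      using k(2)[of v] B[of v] by (simp add: Psi_def)
    finally show ?thesis by simp
  qed
  then show ?thesis by (intro bdd_belowI) blast
qed

text \<open>
  Strong convexity in the form of the parallelogram law: it makes every minimizing sequence
  of \<open>Psi\<close> a Cauchy sequence.
\<close>
lemma Psi_midpoint:
  assumes "linear b"
  shows "a (u - v) (u - v) = 4 * Psi a b u + 4 * Psi a b v - 8 * Psi a b ((1/2) *\<^sub>R (u + v))"
proof -
  have diff: "a (u - v) (u - v) = a u u - 2 * a u v + a v v"
    using sym[of u v] by (simp add: diff_left diff_right)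
  have form_half: "a ((1/2) *\<^sub>R (u + v)) ((1/2) *\<^sub>R (u + v)) = a u u / 4 + a u v / 2 + a v v / 4"
    by (simp only: scaleR_left scaleR_right form_add) simp
  have functional_half: "b ((1/2) *\<^sub>R (u + v)) = b u / 2 + b v / 2"
    by (simp only: linear_scale[OF assms] linear_add[OF assms]) simp
  show ?thesis
    by (simp only: Psi_def diff form_half functional_half) (simp add: field_simps)
qed

lemma Psi_has_minimizer:
  assumes b: "bounded_linear b"
  obtains z where "\<And>v. Psi a b z \<le> Psi a b v"
proof -
  have lin: "linear b"
    using b by (rule bounded_linear.linear)
  obtain k where k: "k > 0" "\<And>v. k * (norm v)\<^sup>2 \<le> a v v"
    using coercive by blast
  define m where "m = Inf (range (Psi a b))"
  have m_le: "m \<le> Psi a b v" for v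
    unfolding m_def by (intro cInf_lower Psi_bounded_below b) simp
  have "\<exists>x. Psi a b x < m + 1 / real (Suc n)" for n
  proof -
    have "Inf (range (Psi a b)) < m + 1 / real (Suc n)"
      by (simp add: m_def)
    then show ?thesis
      using cInf_lessD[of "range (Psi a b)"] by blast
  qed
  then obtain x where x: "\<And>n. Psi a b (x n) < m + 1 / real (Suc n)"
    by metis
  have "Cauchy x"
  proof (rule metric_CauchyI)
    fix e :: real assume "e > 0"
    then obtain M where M: "inverse (real (Suc M)) < k * e\<^sup>2 / 8"
      using k(1) reals_Archimedean[of "k * e\<^sup>2 / 8"] by auto
    have "dist (x i) (x j) < e" if "i \<ge> M" "j \<ge> M" for i j
    proof -
      have x_le: "Psi a b (x l) \<le> m + inverse (real (Suc M))" if "l \<ge> M" for l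
      proof -
        have "1 / real (Suc l) \<le> inverse (real (Suc M))"
          using that by (simp add: field_simps)
        then show ?thesis using x[of l] by linarith
      qed
      have "k * (norm (x i - x j))\<^sup>2 \<le> a (x i - x j) (x i - x j)"
        by (rule k(2))
      also have "\<dots> < k * e\<^sup>2"
        using Psi_midpoint[OF lin, of "x i" "x j"] x_le[OF \<open>i \<ge> M\<close>] x_le[OF \<open>j \<ge> M\<close>]
          m_le[of "(1/2) *\<^sub>R (x i + x j)"] M by linarith
      finally have "(norm (x i - x j))\<^sup>2 < e\<^sup>2"
        using k(1) by simp
      then show ?thesis
        using \<open>e > 0\<close> by (simp add: dist_norm power_less_imp_less_base)
    qed
    then show "\<exists>M. \<forall>i\<ge>M. \<forall>j\<ge>M. dist (x i) (x j) < e" by blast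
  qed
  then obtain z where z: "x \<longlonglongrightarrow> z"
    using Cauchy_convergent convergent_def by blast
  have "(\<lambda>n. Psi a b (x n)) \<longlonglongrightarrow> Psi a b z"
    unfolding Psi_def
    by (intro tendsto_intros tendsto z bounded_linear.tendsto[OF b])
  moreover have "(\<lambda>n. m + 1 / real (Suc n)) \<longlonglongrightarrow> m + 0"
    by (intro tendsto_add tendsto_const lim_1_over_n LIMSEQ_Suc)
  ultimately have "Psi a b z \<le> m + 0"
    using x by (intro LIMSEQ_le[of "\<lambda>n. Psi a b (x n)"]) (auto intro: less_imp_le)
  then show thesis
    using m_le that by (metis add.right_neutral order_trans)
qed

text \<open>
  The first variation of \<open>Psi\<close> vanishes at its minimizer. Together with the existence of the
  minimizer this is the Riesz representation of \<open>b\<close> in the energy inner product.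
\<close>
lemma Psi_minimizer_represents:
  assumes b: "bounded_linear b"
  shows "a (Psi_minimizer a b UNIV) v = b v"
proof -
  have lin: "linear b"
    using b by (rule bounded_linear.linear)
  obtain x where "\<And>v. Psi a b x \<le> Psi a b v"
    using Psi_has_minimizer[OF b] by blast
  then have "is_arg_min (Psi a b) (\<lambda>w. w \<in> UNIV) x"
    by (simp add: is_arg_min_linorder)
  then have "is_arg_min (Psi a b) (\<lambda>w. w \<in> UNIV) (Psi_minimizer a b UNIV)"
    unfolding Psi_minimizer_def arg_min_def by (rule someI)
  then obtain z where z: "z = Psi_minimizer a b UNIV" and min: "\<And>w. Psi a b z \<le> Psi a b w"
    by (simp add: is_arg_min_linorder)
  define d where "d = a z v - b v"
  have variation: "0 \<le> t * d + t\<^sup>2 * a v v / 2" for t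
  proof -
    have "Psi a b (z + t *\<^sub>R v) = Psi a b z + t * d + t\<^sup>2 * a v v / 2"
      by (simp add: Psi_add[OF lin] d_def linear_scale[OF lin] scaleR_left scaleR_right
          power2_eq_square algebra_simps)
    then show ?thesis using min[of "z + t *\<^sub>R v"] by linarith
  qed
  have "d = 0"
  proof (cases "v = 0")
    case True
    then show ?thesis by (simp add: d_def zero_right linear_0[OF lin])
  next
    case False
    then have "a v v > 0"
      using nonneg[of v] eq_0_iff[of v] by linarith
    \<comment> \<open>the vertex of the parabola, where the variation is smallest\<close>
    then have "0 \<le> - (d\<^sup>2) / (2 * a v v)"
      using variation[of "- d / a v v"] by (simp add: power2_eq_square field_simps)
    then show ?thesis
      using \<open>a v v > 0\<close> by (simp add: divide_le_0_iff)
  qed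
  then show ?thesis by (simp add: z d_def)
qed

text \<open>
  Energy projections onto finite-dimensional subspaces exist by one Gram--Schmidt step per
  generator; this is what makes the minimum over \<open>W(u)\<close> attained.
\<close>
lemma projection_exists:
  assumes "finite B"
  shows "\<exists>p\<in>span B. \<forall>w\<in>span B. a (x - p) w = 0"
  using assms
proof (induction B arbitrary: x)
  case empty
  then show ?case by (simp add: zero_right)
next
  case (insert e B)
  obtain q where q: "q \<in> span B" "\<And>w. w \<in> span B \<Longrightarrow> a (e - q) w = 0"
    using insert.IH by blast
  obtain p where p: "p \<in> span B" "\<And>w. w \<in> span B \<Longrightarrow> a (x - p) w = 0"
    using insert.IH by blast
  define r where "r = e - q"
  \<comment> \<open>if \<open>r = 0\<close>, then \<open>e\<close> already lies in the span of \<open>B\<close> and division by zero gives \<open>t = 0\<close>\<close>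
  define t where "t = a (x - p) r / a r r"
  have r_perp: "a r w = 0" if "w \<in> span B" for w
    using q(2) that by (simp add: r_def)
  have pr: "a (x - p - t *\<^sub>R r) r = 0"
    using eq_0_iff[of r] by (auto simp: t_def diff_left scaleR_left zero_right)
  have sub: "span B \<subseteq> span (insert e B)"
    by (intro span_mono) auto
  have "p + t *\<^sub>R r \<in> span (insert e B)"
    unfolding r_def using p(1) q(1) sub
    by (intro span_add span_scale span_diff) (auto intro: span_base)
  moreover have "a (x - (p + t *\<^sub>R r)) w = 0" if "w \<in> span (insert e B)" for w
  proof -
    obtain s where s: "w - s *\<^sub>R e \<in> span B"
      using \<open>w \<in> span (insert e B)\<close> by (auto simp: span_insert)
    define y where "y = (w - s *\<^sub>R e) + s *\<^sub>R q"
    have y: "y \<in> span B"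
      unfolding y_def using s q(1) by (intro span_add span_scale)
    have "w = y + s *\<^sub>R r"
      by (simp add: y_def r_def algebra_simps)
    then have "a (x - (p + t *\<^sub>R r)) w
        = a (x - p) y - t * a r y + s * a (x - p - t *\<^sub>R r) r"
      by (simp add: add_right scaleR_right diff_left scaleR_left add_left algebra_simps)
    then show ?thesis
      using p(2)[OF y] r_perp[OF y] pr by simp
  qed
  ultimately show ?case by blast
qed

text \<open>
  By Pythagoras, a point \<open>z\<close> with residual orthogonal to all directions of \<open>S\<close> is the strict
  minimizer, so the choice made by \<open>arg_min\<close> has to be \<open>z\<close>.
\<close>
lemma Psi_minimizer_eqI:
  assumes b: "linear b" and rep: "\<And>v. a uhat v = b v"
    and z: "z \<in> S" and perp: "\<And>y. y \<in> S \<Longrightarrow> a (z - uhat) (y - z) = 0"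
  shows "Psi_minimizer a b S = z"
proof -
  have less: "Psi a b z < Psi a b y" if "y \<in> S" "y \<noteq> z" for y
  proof -
    have "Psi a b y = Psi a b z + a (y - z) (y - z) / 2"
      using Psi_add[OF b, of z "y - z"] perp[OF \<open>y \<in> S\<close>] rep[of "y - z"]
      by (simp add: diff_left)
    moreover have "a (y - z) (y - z) > 0"
      using nonneg[of "y - z"] eq_0_iff[of "y - z"] \<open>y \<noteq> z\<close> by simp
    ultimately show ?thesis by simp
  qed
  have "is_arg_min (Psi a b) (\<lambda>w. w \<in> S) x \<longleftrightarrow> x = z" for x
    using less z unfolding is_arg_min_def by (metis order_less_asym)
  then show ?thesis
    by (simp add: Psi_minimizer_def arg_min_def)
qed

end

section \<open>The collage operator\<close>

locale collage_problem = elliptic_form a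
  for a :: "'h::{real_normed_vector,complete_space} \<Rightarrow> 'h \<Rightarrow> real" +
  fixes b :: "'h \<Rightarrow> real"
    and F :: "'h \<Rightarrow> 'p::euclidean_space \<Rightarrow> 'h"
    and c c1 c2 :: real
    and uhat :: 'h
  assumes b: "bounded_linear b"
    and uhat: "uhat = Psi_minimizer a b UNIV"
    and c1: "c1 > 0" and c2: "c2 > 0"
    and lower: "c1 * norm v \<le> energy_norm a v"
    and upper: "energy_norm a v \<le> c2 * norm v"
    and F_linear: "linear (\<lambda>(u, \<alpha>). F u \<alpha>)"
    and F_contractive: "norm (F u \<alpha> - F v \<alpha>) \<le> c * norm (u - v)"
begin

lemma F_add: "F (u + v) (\<alpha> + \<beta>) = F u \<alpha> + F v \<beta>"
  using linear_add[OF F_linear, of "(u, \<alpha>)" "(v, \<beta>)"] by simp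

lemma F_scale: "F (r *\<^sub>R u) (r *\<^sub>R \<alpha>) = r *\<^sub>R F u \<alpha>"
  using linear_scale[OF F_linear, of r "(u, \<alpha>)"] by simp

lemma F_diff: "F (u - v) (\<alpha> - \<beta>) = F u \<alpha> - F v \<beta>"
  using linear_diff[OF F_linear, of "(u, \<alpha>)" "(v, \<beta>)"] by simp

lemma F_split: "F u \<alpha> = F u 0 + F 0 \<alpha>"
  using F_add[of u 0 0 \<alpha>] by simp

lemma W_space_eq_span: "W_space F = span (F 0 ` Basis)"
proof -
  have "linear (F 0)"
    using F_add[of 0 0] F_scale[of _ 0] by (intro linearI) simp_all
  then have "span (F 0 ` Basis) = range (F 0)"
    by (simp add: span_linear_image)
  then show ?thesis by (auto simp: W_space_def)
qed

lemma W_affine_iff: "y \<in> W_affine F u \<longleftrightarrow> y - F u 0 \<in> W_space F"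
  by (force simp: W_affine_def)

lemma F_in_W_affine: "F u \<alpha> \<in> W_affine F u"
  by (auto simp: W_affine_iff W_space_def F_split[of u \<alpha>])

text \<open>The normal equations, which characterize \<open>G u\<close> as the energy projection of \<open>uhat\<close>.\<close>
lemma G_op_projection:
  shows G_op_in_W_affine: "G_op a b F u \<in> W_affine F u"
    and G_op_orthogonal: "w \<in> W_space F \<Longrightarrow> a (G_op a b F u - uhat) w = 0"
proof -
  obtain p where p: "p \<in> W_space F" "\<And>w. w \<in> W_space F \<Longrightarrow> a (uhat - F u 0 - p) w = 0"
    unfolding W_space_eq_span using projection_exists[of "F 0 ` Basis"] by fastforce
  define z where "z = F u 0 + p"
  have z: "z \<in> W_affine F u"
    using p(1) by (simp add: W_affine_iff z_def)
  have perp: "a (z - uhat) w = 0" if "w \<in> W_space F" for w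
  proof -
    have "a (z - uhat) w = - a (uhat - F u 0 - p) w"
      by (simp add: z_def diff_left add_left)
    then show ?thesis using p(2)[OF that] by simp
  qed
  have "G_op a b F u = z"
    unfolding G_op_def
  proof (rule Psi_minimizer_eqI[where uhat = uhat])
    show "linear b" using b by (rule bounded_linear.linear)
    show "a uhat v = b v" for v
      unfolding uhat by (rule Psi_minimizer_represents[OF b])
    fix y assume "y \<in> W_affine F u"
    then have "(y - F u 0) - (z - F u 0) \<in> W_space F"
      using z unfolding W_affine_iff W_space_eq_span by (rule span_diff)
    then show "a (z - uhat) (y - z) = 0"
      using perp by simp
  qed (fact z)
  with z perp show "G_op a b F u \<in> W_affine F u"
    and "w \<in> W_space F \<Longrightarrow> a (G_op a b F u - uhat) w = 0"
    by simp_all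
qed

lemma form_le_add_orthogonal:
  assumes "a u v = 0"
  shows "a u u \<le> a (u + v) (u + v)"
  using form_add[of u v] assms nonneg[of v] by simp

lemma norm_le_if_energy_le:
  assumes "a u u \<le> a v v"
  shows "norm u \<le> c2 / c1 * norm v"
proof -
  have "c1 * norm u \<le> c2 * norm v"
    using lower[of u] upper[of v] assms energy_norm_le_iff[of u v] by linarith
  then show ?thesis using c1 by (simp add: field_simps)
qed

lemma G_op_contraction:
  "norm (G_op a b F u - G_op a b F v) \<le> c * c2 / c1 * norm (u - v)"
proof -
  define d where "d = G_op a b F u - G_op a b F v"
  define w where "w = F (u - v) 0 - d"
  have "w = (G_op a b F v - F v 0) - (G_op a b F u - F u 0)"
    using F_diff[of u v 0 0] by (simp add: w_def d_def)
  then have w: "w \<in> W_space F"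
    using G_op_in_W_affine[of u] G_op_in_W_affine[of v]
    unfolding W_affine_iff W_space_eq_span by (simp add: span_diff)
  have "a d w = 0"
    using G_op_orthogonal[OF w, of u] G_op_orthogonal[OF w, of v] by (simp add: d_def diff_left)
  then have "a d d \<le> a (F (u - v) 0) (F (u - v) 0)"
    using form_le_add_orthogonal[of d w] by (simp add: w_def)
  then have "norm d \<le> c2 / c1 * norm (F (u - v) 0)"
    by (rule norm_le_if_energy_le)
  also have "\<dots> \<le> c2 / c1 * (c * norm (u - v))"
    using F_contractive[of u 0 v] F_diff[of u v 0 0] c1 c2
    by (intro mult_left_mono) simp_all
  finally show ?thesis by (simp add: d_def mult_ac)
qed

text \<open>
  The parameter \<open>\<alpha>\<close> for which \<open>v\<close> is a fixed point yields the competitor \<open>F(uhat; \<alpha>)\<close>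
  in the minimization over \<open>W(uhat)\<close>.
\<close>
lemma G_op_displacement:
  assumes "v \<in> V_space F"
  shows "norm (uhat - G_op a b F uhat) \<le> c2 / c1 * ((1 + c) * norm (v - uhat))"
proof -
  obtain \<alpha> where \<alpha>: "v = F v \<alpha>"
    using assms by (auto simp: V_space_def)
  define g where "g = G_op a b F uhat"
  have "(F uhat \<alpha> - F uhat 0) - (g - F uhat 0) \<in> W_space F"
    using F_in_W_affine[of uhat \<alpha>] G_op_in_W_affine[of uhat]
    unfolding g_def W_affine_iff W_space_eq_span by (rule span_diff)
  then have "a (g - uhat) (F uhat \<alpha> - g) = 0"
    using G_op_orthogonal by (simp add: g_def)
  then have "a (g - uhat) (g - uhat) \<le> a (F uhat \<alpha> - uhat) (F uhat \<alpha> - uhat)"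
    using form_le_add_orthogonal[of "g - uhat" "F uhat \<alpha> - g"] by simp
  then have "norm (g - uhat) \<le> c2 / c1 * norm (F uhat \<alpha> - uhat)"
    by (rule norm_le_if_energy_le)
  also have "norm (F uhat \<alpha> - uhat) \<le> (1 + c) * norm (v - uhat)"
  proof -
    have "F uhat \<alpha> - uhat = (F uhat \<alpha> - F v \<alpha>) + (v - uhat)"
      using \<alpha> by simp
    then have "norm (F uhat \<alpha> - uhat) \<le> norm (F uhat \<alpha> - F v \<alpha>) + norm (v - uhat)"
      by (metis norm_triangle_ineq)
    also have "\<dots> \<le> c * norm (v - uhat) + norm (v - uhat)"
      using F_contractive[of uhat \<alpha> v] by (simp add: norm_minus_commute)
    finally show ?thesis by (simp add: algebra_simps)
  qed
  finally show ?thesis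
    using c1 c2 by (simp add: g_def norm_minus_commute divide_right_mono)
qed

lemma fixed_point_in_V_space:
  assumes "u = G_op a b F u"
  shows "u \<in> V_space F"
proof -
  have "u \<in> W_affine F u"
    using assms G_op_in_W_affine by metis
  then obtain \<alpha> where "u = F u 0 + F 0 \<alpha>"
    by (auto simp: W_affine_def W_space_def)
  then have "u = F u \<alpha>"
    using F_split[of u \<alpha>] by simp
  then show ?thesis
    by (auto simp: V_space_def)
qed

text \<open>
  Identifying the definite description \<open>collage_fit\<close> with a fixed point of \<open>G\<close> needs both
  existence and uniqueness, which the contraction principle supplies.
\<close>
lemma collage_fit_fixed_point:
  assumes "0 \<le> c" and "c * c2 / c1 < 1"
  shows "collage_fit a b F = G_op a b F (collage_fit a b F)"
proof -
  have "\<exists>!u. G_op a b F u = u"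
  proof (rule banach_fix_type)
    show "0 \<le> c * c2 / c1" using assms c1 c2 by simp
    show "\<forall>u v. dist (G_op a b F u) (G_op a b F v) \<le> c * c2 / c1 * dist u v"
      using G_op_contraction by (simp add: dist_norm)
  qed (fact assms(2))
  then have "\<exists>!u. u \<in> V_space F \<and> u = G_op a b F u"
    using fixed_point_in_V_space by metis
  then show ?thesis
    unfolding collage_fit_def by (rule theI'[THEN conjunct2])
qed

text \<open>
  The collage estimate: the error exceeds the displacement of \<open>uhat\<close> by at most
  the contraction constant times the error itself.
\<close>
lemma collage_fit_error:
  assumes "0 \<le> c" and lt1: "c * c2 / c1 < 1" and v: "v \<in> V_space F"
  shows "(1 - c * c2 / c1) * norm (collage_fit a b F - uhat)
    \<le> c2 / c1 * ((1 + c) * norm (v - uhat))"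
proof -
  let ?u = "collage_fit a b F"
  have "?u - uhat = (G_op a b F ?u - G_op a b F uhat) - (uhat - G_op a b F uhat)"
    using collage_fit_fixed_point[OF assms(1) lt1] by simp
  then have "norm (?u - uhat)
      \<le> norm (G_op a b F ?u - G_op a b F uhat) + norm (uhat - G_op a b F uhat)"
    by (metis norm_triangle_ineq4)
  then show ?thesis
    using G_op_contraction[of ?u uhat] G_op_displacement[OF v] unfolding left_diff_distrib
    by linarith
qed

end

section \<open>The error bound\<close>

theorem proposition6p3:
  fixes X :: "'x set"
    and reps :: "'h::{real_inner,complete_space} \<Rightarrow> ('x \<Rightarrow> real) set"
    and a :: "'h \<Rightarrow> 'h \<Rightarrow> real"
    and b :: "'h \<Rightarrow> real"
    and F :: "'h \<Rightarrow> real ^ 'm \<Rightarrow> 'h"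
    and c c\<^sub>1 c\<^sub>2 \<gamma> :: real
    and uhat utilde :: 'h
  assumes "function_space_on X reps"
    and "\<forall>u v. a u v = a v u"
    and "H_elliptic a"
    and "bounded_linear b"
    and "uhat = Psi_minimizer a b UNIV"
    and "c\<^sub>1 > 0" and "c\<^sub>2 > 0"
    and "\<forall>v. c\<^sub>1 * norm v \<le> energy_norm a v \<and> energy_norm a v \<le> c\<^sub>2 * norm v"
    and "\<forall>\<alpha>. rb_operator X reps (\<lambda>u. F u \<alpha>)"
    and "linear (\<lambda>(u, \<alpha>). F u \<alpha>)"
    and "0 < c" and "c < 1"
    and "\<forall>u v \<alpha>. norm (F u \<alpha> - F v \<alpha>) \<le> c * norm (u - v)"
    and "c < c\<^sub>1 / c\<^sub>2"
    and "\<gamma> = c * c\<^sub>2 / c\<^sub>1"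
    and "utilde = collage_fit a b F"
  shows "\<forall>u\<^sub>N \<in> V_space F.
    norm (utilde - uhat) \<le> (1 / c + 1) / (1 / \<gamma> - 1) * norm (u\<^sub>N - uhat)"
proof
  fix u\<^sub>N assume u\<^sub>N: "u\<^sub>N \<in> V_space F"
  interpret collage_problem a b F c c\<^sub>1 c\<^sub>2 uhat
  proof (intro collage_problem.intro elliptic_form.intro collage_problem_axioms.intro)
    show "a u v = a v u" for u v
      using assms(2) by blast
    show "c\<^sub>1 * norm v \<le> energy_norm a v" and "energy_norm a v \<le> c\<^sub>2 * norm v" for v
      using assms(8) by blast+
    show "norm (F u \<alpha> - F v \<alpha>) \<le> c * norm (u - v)" for u v \<alpha>
      using assms(13) by blast
  qed (fact assms)+
  have \<gamma>: "0 < \<gamma>" "\<gamma> < 1" and ratio: "c\<^sub>2 / c\<^sub>1 = \<gamma> / c"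
    unfolding assms(15) using assms(6,7,11,14) by (simp_all add: field_simps)
  have "(1 - \<gamma>) * norm (utilde - uhat) \<le> \<gamma> / c * ((1 + c) * norm (u\<^sub>N - uhat))"
    using collage_fit_error[OF _ _ u\<^sub>N, folded assms(15,16), unfolded ratio] \<gamma>(2) assms(11)
    by simp
  then have "norm (utilde - uhat) \<le> \<gamma> / c * ((1 + c) * norm (u\<^sub>N - uhat)) / (1 - \<gamma>)"
    using \<gamma>(2) by (subst pos_le_divide_eq) (simp_all only: mult.commute diff_gt_0_iff_gt)
  also have "\<dots> = ((1 + c) / c) / ((1 - \<gamma>) / \<gamma>) * norm (u\<^sub>N - uhat)"
    by simp
  also have "(1 + c) / c = 1 / c + 1"
    using assms(11) by (simp add: add_divide_distrib)
  also have "(1 - \<gamma>) / \<gamma> = 1 / \<gamma> - 1"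
    using \<gamma>(1) by (simp add: diff_divide_distrib)
  finally show "norm (utilde - uhat) \<le> (1 / c + 1) / (1 / \<gamma> - 1) * norm (u\<^sub>N - uhat)" .
qed

end
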